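(* Let $X$ be a smooth projective complex curve of genus $g\ge 1$, $N$ a line bundle on $X$, $\delta\in\mathbb{Q}_{>0}$, and let $(E,Q)$ be a quadric bundle on $X$, i.e. $E$ is a vector bundle on $X$ and $Q\colon\mathrm{Sym}^2E\to N$ is a nonzero morphism of vector bundles. Then it is enough to check the $\delta$-semistability condition on subbundles and on critical weighted filtrations of length two. That is: $(E,Q)$ is $\delta$-semistable (respectively $\delta$-stable) if and only if $P(E^\bullet,\underline\alpha)+\delta\,\mu(E^\bullet,\underline\alpha;Q)\ge 0$ (respectively $>0$) both for every weighted filtration of length one $0\subsetneq F\subsetneq E$ and for every critical weighted filtration $(0\subsetneq E_1\subsetneq E_2\subsetneq E;\ \alpha_1,\alpha_2)$ of length two.
   Context: Let $r=\mathrm{rk}(E)$ and $d=\deg(E)$. A weighted filtration $(E^\bullet,\underline\alpha)$ of $E$ of length $t\ge 1$ consists of a chain of subbundles $0\subsetneq E_1\subsetneq\cdots\subsetneq E_t\subsetneq E$ together with a vector $\underline\alpha=(\alpha_1,\dots,\alpha_t)$ of positive rational weights. Put $E_{t+1}=E$, $r_i=\mathrm{rk}(E_i)$, $d_i=\deg(E_i)$. Define $$P(E^\bullet,\underline\alpha)=\sum_{i=1}^t\alpha_i\,(d\,r_i-r\,d_i),$$ $$\gamma=\sum_{i=1}^t\alpha_i\,(\underbrace{r_i-r,\dots,r_i-r}_{r_i\text{ times}},\underbrace{r_i,\dots,r_i}_{r-r_i\text{ times}})\in\mathbb{Q}^r,$$ and let $\gamma^{(i)}$, for $i\in\{1,\dots,t+1\}$,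 denote the $r_i$-th entry of $\gamma$. For subbundles $A,B\subset E$, $AB$ denotes the subbundle of $\mathrm{Sym}^2E$ generated by products $ab$ of local sections $a$ of $A$ and $b$ of $B$. Define $$\mu(E^\bullet,\underline\alpha;Q)=-\min_{i,j\in\{1,\dots,t+1\}}\{\gamma^{(i)}+\gamma^{(j)}\;:\;Q|_{E_iE_j}\not\equiv 0\}.$$ The quadric bundle $(E,Q)$ is $\delta$-semistable (respectively $\delta$-stable) if $P(E^\bullet,\underline\alpha)+\delta\,\mu(E^\bullet,\underline\alpha;Q)\ge 0$ (respectively $>0$) for every weighted filtration $(E^\bullet,\underline\alpha)$ of $E$ of any length. A weighted filtration is called non-critical if $\mu(E^\bullet,\underline\alpha;Q)=\sum_{i=1}^t\mu(0\subset E_i\subset E,\alpha_i;Q)$, and critical otherwise. *)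

theory Defs
  imports
    "HOL-Analysis.Analysis"
    "HOL-Combinatorics.Permutations"
    "HOL-Library.Function_Algebras"
    "HOL-Library.Extended_Nat"
begin

section \<open>Projective space and regular functions\<close>

text \<open>Varieties are classical ones: sets of closed points of the projective space of lines
  in \<open>complex ^ 'n\<close>, with the Zariski topology.\<close>

definition homogeneous_poly :: "nat \<Rightarrow> (complex ^ 'n \<Rightarrow> complex) \<Rightarrow> bool" where
  "homogeneous_poly k F \<longleftrightarrow>
     (\<exists>M c. finite M \<and> (\<forall>m\<in>M. (\<Sum>i\<in>UNIV. m i) = k) \<and>
        F = (\<lambda>v. \<Sum>m\<in>M. c m * (\<Prod>i\<in>UNIV. (v $ i) ^ (m i :: nat))))"

definition proj_space :: "(complex ^ 'n) set set" where
  "proj_space = {L. vec.subspace L \<and> vec.dim L = 1}"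

text \<open>The principal open sets are a basis of the Zariski topology.\<close>

definition zariski :: "(complex ^ 'n) set topology" where
  "zariski = topology_generated_by
     {{L \<in> proj_space. \<exists>v\<in>L. F v \<noteq> 0} | F k. homogeneous_poly k F}"

abbreviation zopen :: "(complex ^ 'n) set set \<Rightarrow> (complex ^ 'n) set set \<Rightarrow> bool" where
  "zopen X U \<equiv> openin (subtopology zariski X) U"

definition regular_on ::
  "(complex ^ 'n) set set \<Rightarrow> (complex ^ 'n) set set \<Rightarrow> ((complex ^ 'n) set \<Rightarrow> complex) \<Rightarrow> bool" where
  "regular_on X U f \<longleftrightarrow>
     (\<forall>x\<in>U. \<exists>W k F G. zopen X W \<and> x \<in> W \<and> W \<subseteq> U \<and>
        homogeneous_poly k F \<and> homogeneous_poly k G \<and>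
        (\<forall>y\<in>W. \<forall>v\<in>y. v \<noteq> 0 \<longrightarrow> G v \<noteq> 0 \<and> f y = F v / G v))"

definition regular_at ::
  "(complex ^ 'n) set set \<Rightarrow> (complex ^ 'n) set \<Rightarrow> ((complex ^ 'n) set \<Rightarrow> complex) \<Rightarrow> bool" where
  "regular_at X x f \<longleftrightarrow> (\<exists>U. zopen X U \<and> x \<in> U \<and> regular_on X U f)"


section \<open>Smooth projective curves and their genus\<close>

definition irreducible_subset :: "'a topology \<Rightarrow> 'a set \<Rightarrow> bool" where
  "irreducible_subset T S \<longleftrightarrow> S \<noteq> {} \<and> S \<subseteq> topspace T \<and>
     (\<forall>A B. closedin T A \<and> closedin T B \<and> S \<subseteq> A \<union> B \<longrightarrow> S \<subseteq> A \<or> S \<subseteq> B)"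

definition krull_dim :: "'a topology \<Rightarrow> enat" where
  "krull_dim T = Sup {enat n | n. \<exists>Z :: nat \<Rightarrow> 'a set.
     (\<forall>i\<le>n. closedin T (Z i) \<and> irreducible_subset T (Z i)) \<and> (\<forall>i<n. Z i \<subset> Z (Suc i))}"

definition fscale :: "complex \<Rightarrow> ('a \<Rightarrow> complex) \<Rightarrow> 'a \<Rightarrow> complex" where
  "fscale c f = (\<lambda>z. c * f z)"

text \<open>The Zariski tangent space: complex-valued derivations of the local ring at \<open>x\<close>. A germ is
  represented by any function regular near \<open>x\<close>; derivations are normalised to vanish on the
  other functions, so that they form a complex vector space under \<open>fscale\<close>.\<close>

definition tangent_space ::
  "(complex ^ 'n) set set \<Rightarrow> (complex ^ 'n) set \<Rightarrow> (((complex ^ 'n) set \<Rightarrow> complex) \<Rightarrow> complex) set" where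
  "tangent_space X x = {D.
     (\<forall>f. \<not> regular_at X x f \<longrightarrow> D f = 0) \<and>
     (\<forall>f g U. regular_at X x f \<and> regular_at X x g \<and> zopen X U \<and> x \<in> U \<and>
        (\<forall>y\<in>U. f y = g y) \<longrightarrow> D f = D g) \<and>
     (\<forall>c f. regular_at X x f \<longrightarrow> D (\<lambda>y. c * f y) = c * D f) \<and>
     (\<forall>f g. regular_at X x f \<and> regular_at X x g \<longrightarrow>
        D (\<lambda>y. f y + g y) = D f + D g \<and>
        D (\<lambda>y. f y * g y) = f x * D g + g x * D f)}"

definition smooth_projective_curve :: "(complex ^ 'n) set set \<Rightarrow> bool" where
  "smooth_projective_curve X \<longleftrightarrow>
     closedin zariski X \<and> irreducible_subset zariski X \<and>
     krull_dim (subtopology zariski X) = 1 \<and>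
     (\<forall>x\<in>X. vector_space.dim fscale (tangent_space X x) = 1)"

text \<open>Global regular 1-forms: families of covectors that are locally of the form
  \<open>\<Sum>i. f\<^sub>i dg\<^sub>i\<close>, where \<open>dg\<close> sends a tangent vector \<open>D\<close> to \<open>D g\<close>.\<close>

definition regular_one_forms ::
  "(complex ^ 'n) set set \<Rightarrow>
   ((complex ^ 'n) set \<times> (((complex ^ 'n) set \<Rightarrow> complex) \<Rightarrow> complex) \<Rightarrow> complex) set" where
  "regular_one_forms X = {\<omega>.
     (\<forall>x D. x \<notin> X \<or> D \<notin> tangent_space X x \<longrightarrow> \<omega> (x, D) = 0) \<and>
     (\<forall>x\<in>X. \<exists>U m f g. zopen X U \<and> x \<in> U \<and>
        (\<forall>i<m. regular_on X U (f i) \<and> regular_on X U (g i)) \<and>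
        (\<forall>y\<in>U. \<forall>D\<in>tangent_space X y. \<omega> (y, D) = (\<Sum>i<(m::nat). f i y * D (g i))))}"

definition genus :: "(complex ^ 'n) set set \<Rightarrow> nat" where
  "genus X = vector_space.dim fscale (regular_one_forms X)"


section \<open>Vector bundles\<close>

text \<open>The fibres are subspaces of one complex vector space \<open>('v, vscale)\<close>, which only serves as
  a container: how the fibres vary with the point is recorded by the atlas alone, whose elements
  are pairs of an open set and a local frame over it. The total space is
  \<open>{(x, v). x \<in> X \<and> v \<in> fibre E x}\<close>.\<close>

record ('p, 'v) vbundle =
  fibre :: "'p \<Rightarrow> 'v set"
  vscale :: "complex \<Rightarrow> 'v \<Rightarrow> 'v"
  atlas :: "('p set \<times> ('p \<Rightarrow> 'v) list) set"

definition frame_on ::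
  "(complex \<Rightarrow> 'v \<Rightarrow> 'v) \<Rightarrow> ('p \<Rightarrow> 'v::ab_group_add set) \<Rightarrow> 'p set \<Rightarrow> ('p \<Rightarrow> 'v) list \<Rightarrow> bool" where
  "frame_on sc F U es \<longleftrightarrow>
     (\<forall>y\<in>U. distinct (map (\<lambda>e. e y) es) \<and>
        \<not> module.dependent sc ((\<lambda>e. e y) ` set es) \<and>
        module.span sc ((\<lambda>e. e y) ` set es) = F y)"

definition regular_section ::
  "(complex ^ 'n) set set \<Rightarrow> ((complex ^ 'n) set, 'v::ab_group_add) vbundle \<Rightarrow>
   (complex ^ 'n) set set \<Rightarrow> ((complex ^ 'n) set \<Rightarrow> 'v) \<Rightarrow> bool" where
  "regular_section X E U s \<longleftrightarrow> zopen X U \<and> (\<forall>y\<in>U. s y \<in> fibre E y) \<and>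
     (\<forall>(V, es)\<in>atlas E. \<exists>c. (\<forall>j<length es. regular_on X (U \<inter> V) (c j)) \<and>
        (\<forall>y\<in>U \<inter> V. s y = (\<Sum>j<length es. vscale E (c j y) ((es ! j) y))))"

text \<open>Requiring every frame to be regular with respect to every chart says exactly that the
  transition matrices between charts are regular with regular inverse.\<close>

definition vector_bundle ::
  "(complex ^ 'n) set set \<Rightarrow> ((complex ^ 'n) set, 'v::ab_group_add) vbundle \<Rightarrow> bool" where
  "vector_bundle X E \<longleftrightarrow> vector_space (vscale E) \<and>
     (\<forall>(V, es)\<in>atlas E. zopen X V \<and> frame_on (vscale E) (fibre E) V es \<and>
        (\<forall>e\<in>set es. regular_section X E V e)) \<and>
     X \<subseteq> (\<Union>(V, es)\<in>atlas E. V) \<and>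
     (\<exists>r. \<forall>x\<in>X. vector_space.dim (vscale E) (fibre E x) = r)"

definition vb_rank ::
  "(complex ^ 'n) set set \<Rightarrow> ((complex ^ 'n) set, 'v::ab_group_add) vbundle \<Rightarrow> nat" where
  "vb_rank X E = (THE r. \<forall>x\<in>X. vector_space.dim (vscale E) (fibre E x) = r)"

definition line_bundle ::
  "(complex ^ 'n) set set \<Rightarrow> ((complex ^ 'n) set, 'v::ab_group_add) vbundle \<Rightarrow> bool" where
  "line_bundle X N \<longleftrightarrow> vector_bundle X N \<and> vb_rank X N = 1"

definition vb_morphism ::
  "(complex ^ 'n) set set \<Rightarrow> ((complex ^ 'n) set, 'v::ab_group_add) vbundle \<Rightarrow>
   ((complex ^ 'n) set, 'w::ab_group_add) vbundle \<Rightarrow> ((complex ^ 'n) set \<Rightarrow> 'v \<Rightarrow> 'w) \<Rightarrow> bool" where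
  "vb_morphism X E F \<Phi> \<longleftrightarrow>
     (\<forall>x\<in>X. \<forall>v\<in>fibre E x. \<Phi> x v \<in> fibre F x \<and>
        (\<forall>w\<in>fibre E x. \<Phi> x (v + w) = \<Phi> x v + \<Phi> x w) \<and>
        (\<forall>c. \<Phi> x (vscale E c v) = vscale F c (\<Phi> x v))) \<and>
     (\<forall>U s. regular_section X E U s \<longrightarrow> regular_section X F U (\<lambda>y. \<Phi> y (s y)))"

text \<open>A subbundle is a family of subspaces of the fibres which locally has a frame consisting of
  regular sections of the ambient bundle; all such frames form its own atlas.\<close>

definition sub_vb ::
  "(complex ^ 'n) set set \<Rightarrow> ((complex ^ 'n) set, 'v::ab_group_add) vbundle \<Rightarrow>
   ((complex ^ 'n) set \<Rightarrow> 'v set) \<Rightarrow> ((complex ^ 'n) set, 'v) vbundle" where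
  "sub_vb X E F = \<lparr>fibre = F, vscale = vscale E,
     atlas = {(U, es). zopen X U \<and> frame_on (vscale E) F U es \<and>
                (\<forall>e\<in>set es. regular_section X E U e)}\<rparr>"

definition subbundle ::
  "(complex ^ 'n) set set \<Rightarrow> ((complex ^ 'n) set, 'v::ab_group_add) vbundle \<Rightarrow>
   ((complex ^ 'n) set \<Rightarrow> 'v set) \<Rightarrow> bool" where
  "subbundle X E F \<longleftrightarrow> (\<forall>x\<in>X. F x \<subseteq> fibre E x) \<and> vector_bundle X (sub_vb X E F)"

definition subbundle_less ::
  "'p set \<Rightarrow> ('p \<Rightarrow> 'v set) \<Rightarrow> ('p \<Rightarrow> 'v set) \<Rightarrow> bool" where
  "subbundle_less X F G \<longleftrightarrow> (\<forall>x\<in>X. F x \<subseteq> G x) \<and> (\<exists>x\<in>X. F x \<noteq> G x)"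


section \<open>Degree\<close>

definition local_parameter ::
  "(complex ^ 'n) set set \<Rightarrow> (complex ^ 'n) set \<Rightarrow> ((complex ^ 'n) set \<Rightarrow> complex) \<Rightarrow> bool" where
  "local_parameter X x \<tau> \<longleftrightarrow> regular_at X x \<tau> \<and> \<tau> x = 0 \<and>
     (\<forall>f. regular_at X x f \<and> f x = 0 \<longrightarrow>
        (\<exists>h U. regular_at X x h \<and> zopen X U \<and> x \<in> U \<and> (\<forall>y\<in>U. f y = h y * \<tau> y)))"

text \<open>\<open>f\<close> has order \<open>k\<close> at \<open>x\<close> as a rational function; its value at \<open>x\<close> itself is ignored.\<close>

definition has_order ::
  "(complex ^ 'n) set set \<Rightarrow> (complex ^ 'n) set \<Rightarrow> ((complex ^ 'n) set \<Rightarrow> complex) \<Rightarrow> int \<Rightarrow> bool" where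
  "has_order X x f k \<longleftrightarrow>
     (\<exists>\<tau> u U. local_parameter X x \<tau> \<and> zopen X U \<and> x \<in> U \<and> regular_on X U u \<and> u x \<noteq> 0 \<and>
        (\<forall>y\<in>U - {x}. f y = u y * \<tau> y powi k))"

definition nat_det :: "nat \<Rightarrow> (nat \<Rightarrow> nat \<Rightarrow> complex) \<Rightarrow> complex" where
  "nat_det r A = (\<Sum>p | p permutes {..<r}. of_int (sign p) * (\<Prod>i<r. A i (p i)))"

text \<open>The order at \<open>x\<close> of \<open>s\<^sub>1 \<and> \<dots> \<and> s\<^sub>r\<close>, a rational section of the determinant line bundle
  given by a frame \<open>ss\<close> over the open set \<open>U\<close>: it is computed in a chart around \<open>x\<close>.\<close>

definition det_order ::
  "(complex ^ 'n) set set \<Rightarrow> ((complex ^ 'n) set, 'v::ab_group_add) vbundle \<Rightarrow>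
   (complex ^ 'n) set set \<Rightarrow> ((complex ^ 'n) set \<Rightarrow> 'v) list \<Rightarrow> (complex ^ 'n) set \<Rightarrow> int" where
  "det_order X E U ss x = (THE k. \<exists>(V, es)\<in>atlas E. x \<in> V \<and>
     (\<exists>c. (\<forall>y\<in>U \<inter> V. \<forall>i<length ss.
             (ss ! i) y = (\<Sum>j<length es. vscale E (c y i j) ((es ! j) y))) \<and>
          has_order X x (\<lambda>y. nat_det (length es) (c y)) k))"

text \<open>The degree of the determinant line bundle, i.e. of the divisor of any of its nonzero
  rational sections; on \<open>U\<close> the section is regular and nowhere zero.\<close>

definition vb_degree ::
  "(complex ^ 'n) set set \<Rightarrow> ((complex ^ 'n) set, 'v::ab_group_add) vbundle \<Rightarrow> int" where
  "vb_degree X E = (THE d. \<exists>U ss. U \<noteq> {} \<and> zopen X U \<and> frame_on (vscale E) (fibre E) U ss \<and>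
     (\<forall>s\<in>set ss. regular_section X E U s) \<and> d = (\<Sum>x\<in>X - U. det_order X E U ss x))"


section \<open>Symmetric squares and quadric bundles\<close>

text \<open>The product \<open>v w\<close> in the symmetric square, realised as the quadratic polynomial function
  \<open>\<phi> \<mapsto> \<phi>(v) \<phi>(w)\<close> on the dual space; over an infinite field the span of these functions is
  the symmetric square.\<close>

definition sym_prod ::
  "(complex \<Rightarrow> 'v \<Rightarrow> 'v::ab_group_add) \<Rightarrow> 'v \<Rightarrow> 'v \<Rightarrow> ('v \<Rightarrow> complex) \<Rightarrow> complex" where
  "sym_prod sc v w = (\<lambda>\<phi>. if Vector_Spaces.linear sc (*) \<phi> then \<phi> v * \<phi> w else 0)"

definition Sym2 ::
  "('p, 'v::ab_group_add) vbundle \<Rightarrow> ('p, ('v \<Rightarrow> complex) \<Rightarrow> complex) vbundle" where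
  "Sym2 E = \<lparr>
     fibre = (\<lambda>x. module.span fscale
       {sym_prod (vscale E) v w | v w. v \<in> fibre E x \<and> w \<in> fibre E x}),
     vscale = fscale,
     atlas = (\<lambda>(U, es).
       (U, [\<lambda>y. sym_prod (vscale E) ((es ! i) y) ((es ! j) y).
              i \<leftarrow> [0..<length es], j \<leftarrow> [i..<length es]])) ` atlas E\<rparr>"

definition nonzero_on ::
  "'p set \<Rightarrow> ('p \<Rightarrow> 'v \<Rightarrow> 'w::zero) \<Rightarrow> ('p \<Rightarrow> 'v set) \<Rightarrow> bool" where
  "nonzero_on X Q S \<longleftrightarrow> (\<exists>x\<in>X. \<exists>v\<in>S x. Q x v \<noteq> 0)"

definition quadric_bundle ::
  "(complex ^ 'n) set set \<Rightarrow> ((complex ^ 'n) set, 'w::ab_group_add) vbundle \<Rightarrow>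
   ((complex ^ 'n) set, 'v::ab_group_add) vbundle \<Rightarrow>
   ((complex ^ 'n) set \<Rightarrow> (('v \<Rightarrow> complex) \<Rightarrow> complex) \<Rightarrow> 'w) \<Rightarrow> bool" where
  "quadric_bundle X N E Q \<longleftrightarrow> vector_bundle X E \<and> vb_morphism X (Sym2 E) N Q \<and>
     nonzero_on X Q (fibre (Sym2 E))"

definition sub_prod ::
  "(complex ^ 'n) set set \<Rightarrow> ((complex ^ 'n) set, 'v::ab_group_add) vbundle \<Rightarrow>
   ((complex ^ 'n) set \<Rightarrow> 'v set) \<Rightarrow> ((complex ^ 'n) set \<Rightarrow> 'v set) \<Rightarrow>
   (complex ^ 'n) set \<Rightarrow> (('v \<Rightarrow> complex) \<Rightarrow> complex) set" where
  "sub_prod X E A B x = module.span fscale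
     {sym_prod (vscale E) (a x) (b x) | a b U. x \<in> U \<and>
        regular_section X E U a \<and> (\<forall>y\<in>U. a y \<in> A y) \<and>
        regular_section X E U b \<and> (\<forall>y\<in>U. b y \<in> B y)}"


section \<open>Weighted filtrations and stability\<close>

text \<open>A filtration of length \<open>t\<close> is the list \<open>[E\<^sub>1, \<dots>, E\<^sub>t]\<close>, so the index \<open>i \<in> {1..t + 1}\<close> of
  \<open>E\<^sub>1, \<dots>, E\<^sub>t, E\<close> becomes the list position \<open>i - 1 \<in> {0..t}\<close>.\<close>

definition weighted_filtration ::
  "(complex ^ 'n) set set \<Rightarrow> ((complex ^ 'n) set, 'v::ab_group_add) vbundle \<Rightarrow>
   ((complex ^ 'n) set \<Rightarrow> 'v set) list \<Rightarrow> rat list \<Rightarrow> bool" where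
  "weighted_filtration X E Fs \<alpha>s \<longleftrightarrow>
     Fs \<noteq> [] \<and> length \<alpha>s = length Fs \<and> (\<forall>\<alpha>\<in>set \<alpha>s. 0 < \<alpha>) \<and>
     (\<forall>F\<in>set Fs. subbundle X E F) \<and>
     sorted_wrt (subbundle_less X) ((\<lambda>x. {0}) # Fs @ [fibre E])"

definition filt_rank ::
  "(complex ^ 'n) set set \<Rightarrow> ((complex ^ 'n) set, 'v::ab_group_add) vbundle \<Rightarrow>
   ((complex ^ 'n) set \<Rightarrow> 'v set) list \<Rightarrow> nat \<Rightarrow> nat" where
  "filt_rank X E Fs i = (if i < length Fs then vb_rank X (sub_vb X E (Fs ! i)) else vb_rank X E)"

definition filt_P ::
  "(complex ^ 'n) set set \<Rightarrow> ((complex ^ 'n) set, 'v::ab_group_add) vbundle \<Rightarrow>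
   ((complex ^ 'n) set \<Rightarrow> 'v set) list \<Rightarrow> rat list \<Rightarrow> rat" where
  "filt_P X E Fs \<alpha>s = (\<Sum>i<length Fs. \<alpha>s ! i *
     (of_int (vb_degree X E) * of_nat (vb_rank X (sub_vb X E (Fs ! i)))
      - of_nat (vb_rank X E) * of_int (vb_degree X (sub_vb X E (Fs ! i)))))"

text \<open>The \<open>k\<close>-th entry of the vector \<open>\<gamma>\<close>, with \<open>k\<close> counted from 1.\<close>

definition filt_gamma ::
  "(complex ^ 'n) set set \<Rightarrow> ((complex ^ 'n) set, 'v::ab_group_add) vbundle \<Rightarrow>
   ((complex ^ 'n) set \<Rightarrow> 'v set) list \<Rightarrow> rat list \<Rightarrow> nat \<Rightarrow> rat" where
  "filt_gamma X E Fs \<alpha>s k = (\<Sum>i<length Fs. \<alpha>s ! i *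
     (if k \<le> filt_rank X E Fs i
      then of_nat (filt_rank X E Fs i) - of_nat (vb_rank X E)
      else of_nat (filt_rank X E Fs i)))"

definition filt_mu ::
  "(complex ^ 'n) set set \<Rightarrow> ((complex ^ 'n) set, 'v::ab_group_add) vbundle \<Rightarrow>
   ((complex ^ 'n) set \<Rightarrow> (('v \<Rightarrow> complex) \<Rightarrow> complex) \<Rightarrow> 'w::ab_group_add) \<Rightarrow>
   ((complex ^ 'n) set \<Rightarrow> 'v set) list \<Rightarrow> rat list \<Rightarrow> rat" where
  "filt_mu X E Q Fs \<alpha>s = - Min
     {filt_gamma X E Fs \<alpha>s (filt_rank X E Fs i) + filt_gamma X E Fs \<alpha>s (filt_rank X E Fs j) | i j.
        i \<le> length Fs \<and> j \<le> length Fs \<and>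
        nonzero_on X Q (sub_prod X E ((Fs @ [fibre E]) ! i) ((Fs @ [fibre E]) ! j))}"

definition delta_semistable ::
  "(complex ^ 'n) set set \<Rightarrow> rat \<Rightarrow> ((complex ^ 'n) set, 'v::ab_group_add) vbundle \<Rightarrow>
   ((complex ^ 'n) set \<Rightarrow> (('v \<Rightarrow> complex) \<Rightarrow> complex) \<Rightarrow> 'w::ab_group_add) \<Rightarrow> bool" where
  "delta_semistable X \<delta> E Q \<longleftrightarrow> (\<forall>Fs \<alpha>s. weighted_filtration X E Fs \<alpha>s \<longrightarrow>
     filt_P X E Fs \<alpha>s + \<delta> * filt_mu X E Q Fs \<alpha>s \<ge> 0)"

definition delta_stable ::
  "(complex ^ 'n) set set \<Rightarrow> rat \<Rightarrow> ((complex ^ 'n) set, 'v::ab_group_add) vbundle \<Rightarrow>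
   ((complex ^ 'n) set \<Rightarrow> (('v \<Rightarrow> complex) \<Rightarrow> complex) \<Rightarrow> 'w::ab_group_add) \<Rightarrow> bool" where
  "delta_stable X \<delta> E Q \<longleftrightarrow> (\<forall>Fs \<alpha>s. weighted_filtration X E Fs \<alpha>s \<longrightarrow>
     filt_P X E Fs \<alpha>s + \<delta> * filt_mu X E Q Fs \<alpha>s > 0)"

definition critical ::
  "(complex ^ 'n) set set \<Rightarrow> ((complex ^ 'n) set, 'v::ab_group_add) vbundle \<Rightarrow>
   ((complex ^ 'n) set \<Rightarrow> (('v \<Rightarrow> complex) \<Rightarrow> complex) \<Rightarrow> 'w::ab_group_add) \<Rightarrow>
   ((complex ^ 'n) set \<Rightarrow> 'v set) list \<Rightarrow> rat list \<Rightarrow> bool" where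
  "critical X E Q Fs \<alpha>s \<longleftrightarrow>
     filt_mu X E Q Fs \<alpha>s \<noteq> (\<Sum>i<length Fs. filt_mu X E Q [Fs ! i] [\<alpha>s ! i])"

end

theory Submission
  imports Defs
begin

text \<open>
  Put \<open>\<phi>(\<alpha>) = max \<Sum>\<^sub>k \<alpha>\<^sub>k ([i \<le> k] + [j \<le> k])\<close>, the maximum being over the pairs \<open>(i, j)\<close> with
  \<open>Q\<close> nonzero on \<open>E\<^sub>i E\<^sub>j\<close>. Then \<open>P + \<delta> \<mu>\<close> is \<open>\<delta> r \<phi>(\<alpha>)\<close> plus a linear function of \<open>\<alpha>\<close>, so it
  suffices to write \<open>\<alpha>\<close> as a sum of vectors supported on a single step or on a critical pair of
  steps, in such a way that \<open>\<phi>\<close> is additive on the sum. The set of pairs is symmetric and upward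
  closed and contains \<open>(t + 1, t + 1)\<close>. If \<open>Q\<close> is nonzero on \<open>E\<^sub>a E\<close> and on \<open>E\<^sub>b E\<^sub>b\<close> but zero on
  \<open>E\<^sub>a E\<^sub>b\<close>, where \<open>a < b\<close> and \<open>b\<close> is the last such step of positive weight for this \<open>a\<close>, then
  subtracting \<open>\<epsilon> = min \<alpha>\<^sub>a \<alpha>\<^sub>b\<close> from both weights lowers \<open>\<phi>\<close> by exactly \<open>2 \<epsilon> = \<phi>(\<epsilon> e\<^sub>a + \<epsilon> e\<^sub>b)\<close>
  and kills one of the weights. If there is no such pair, \<open>\<phi>(\<alpha>) = \<Sum>\<^sub>k \<phi>(\<alpha>\<^sub>k e\<^sub>k)\<close>.
\<close>

section \<open>Piecewise linear functions on a staircase\<close>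

text \<open>Indices are list positions: \<open>k < t\<close> is a step carrying the weight
  \<open>\<alpha> k\<close>, and \<open>t\<close> stands for \<open>E\<close> itself. For a
  filtration with total \<open>s = \<Sum>k<t. \<alpha> k * rank k\<close> and
  \<open>r = rank E\<close>, the sum of the entries of gamma for positions \<open>i\<close> and
  \<open>j\<close> is \<open>2 * s - r * step_val t \<alpha> i j\<close>; the sign turns the minimum
  in mu into a maximum here.\<close>

definition step_val :: "nat \<Rightarrow> (nat \<Rightarrow> rat) \<Rightarrow> nat \<Rightarrow> nat \<Rightarrow> rat" where
  "step_val t \<alpha> i j = (\<Sum>k<t. \<alpha> k * (of_bool (i \<le> k) + of_bool (j \<le> k)))"

definition step_max :: "nat \<Rightarrow> (nat \<Rightarrow> nat \<Rightarrow> bool) \<Rightarrow> (nat \<Rightarrow> rat) \<Rightarrow> rat" where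
  "step_max t S \<alpha> = Max {step_val t \<alpha> i j | i j. i \<le> t \<and> j \<le> t \<and> S i j}"

lemma finite_pairs_image: "finite {f i j | i j. i \<le> (t::nat) \<and> j \<le> (t::nat) \<and> S i j}"
proof -
  have "{f i j | i j. i \<le> t \<and> j \<le> t \<and> S i j} \<subseteq> (\<lambda>(i, j). f i j) ` ({..t} \<times> {..t})"
    by auto
  then show ?thesis
    by (rule finite_subset) simp
qed

text \<open>Isolates what the combinatorics uses about "\<open>Q\<close> is nonzero on the product
  of steps \<open>i\<close> and \<open>j\<close>": products commute, they grow along the chain, and
  \<open>Q\<close> is nonzero.\<close>

locale staircase =
  fixes t :: nat and S :: "nat \<Rightarrow> nat \<Rightarrow> bool"
  assumes sym: "S i j \<Longrightarrow> S j i"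
    and up: "S i j \<Longrightarrow> i \<le> i' \<Longrightarrow> j \<le> j' \<Longrightarrow> i' \<le> t \<Longrightarrow> j' \<le> t \<Longrightarrow> S i' j'"
    and top: "S t t"
begin

lemma step_val_le_max: "i \<le> t \<Longrightarrow> j \<le> t \<Longrightarrow> S i j \<Longrightarrow> step_val t \<alpha> i j \<le> step_max t S \<alpha>"
  unfolding step_max_def by (rule Max_ge[OF finite_pairs_image]) auto

lemma step_max_attained:
  obtains i j where "i \<le> j" "j \<le> t" "S i j" "step_max t S \<alpha> = step_val t \<alpha> i j"
proof -
  have "step_max t S \<alpha> \<in> {step_val t \<alpha> i j | i j. i \<le> t \<and> j \<le> t \<and> S i j}"
    unfolding step_max_def by (rule Max_in[OF finite_pairs_image]) (use top in auto)
  then obtain i j where ij: "i \<le> t" "j \<le> t" "S i j" "step_max t S \<alpha> = step_val t \<alpha> i j"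
    by blast
  have "step_val t \<alpha> i j = step_val t \<alpha> j i"
    by (simp add: step_val_def add.commute)
  then show thesis
    using that[of i j] that[of j i] ij sym by (metis nat_le_linear)
qed

text \<open>For \<open>i \<le> j\<close> with \<open>S i j\<close>, the inequality
  \<open>i \<le> k\<close> forces \<open>S k t\<close> and \<open>j \<le> k\<close> forces
  \<open>S k k\<close>, which bounds the maximum termwise. The bound is attained at
  \<open>(a, b)\<close>, where \<open>a\<close> and \<open>b\<close> are the first positions of
  positive weight satisfying \<open>S a t\<close> and \<open>S b b\<close>; the hypothesis
  \<open>nc\<close> puts this pair into \<open>S\<close>.\<close>

lemma step_max_noncritical:
  assumes nonneg: "\<And>k. k < t \<Longrightarrow> 0 \<le> \<alpha> k"
    and nc: "\<And>a b. a < b \<Longrightarrow> b < t \<Longrightarrow> 0 < \<alpha> a \<Longrightarrow> 0 < \<alpha> b \<Longrightarrow> S a t \<Longrightarrow> S b b \<Longrightarrow> S a b"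
  shows "step_max t S \<alpha> = (\<Sum>k<t. \<alpha> k * (of_bool (S k t) + of_bool (S k k)))"
proof (rule antisym)
  obtain i j where ij: "i \<le> j" "j \<le> t" "S i j" "step_max t S \<alpha> = step_val t \<alpha> i j"
    by (rule step_max_attained)
  have "(of_bool (i \<le> k) + of_bool (j \<le> k) :: rat) \<le> of_bool (S k t) + of_bool (S k k)"
    if "k < t" for k
    using ij that up[of i j k k] up[of i j k t] by auto
  then show "step_max t S \<alpha> \<le> (\<Sum>k<t. \<alpha> k * (of_bool (S k t) + of_bool (S k k)))"
    unfolding ij(4) step_val_def by (intro sum_mono mult_left_mono) (auto intro: nonneg)
next
  define supp where "supp k \<longleftrightarrow> k = t \<or> k < t \<and> 0 < \<alpha> k" for k
  define a where "a = (LEAST k. supp k \<and> S k t)"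
  define b where "b = (LEAST k. supp k \<and> S k k)"
  have a: "supp a" "S a t"
    using LeastI[of "\<lambda>k. supp k \<and> S k t" t] top by (auto simp: a_def supp_def)
  have b: "supp b" "S b b"
    using LeastI[of "\<lambda>k. supp k \<and> S k k" t] top by (auto simp: b_def supp_def)
  have bt: "b \<le> t" using b by (auto simp: supp_def)
  have "a \<le> b"
    unfolding a_def by (rule Least_le) (use b up[of b b b t] bt in auto)
  then have "S a b"
    using nc[of a b] a b by (cases "a = b"; cases "b = t") (auto simp: supp_def)
  have le_a: "a \<le> k \<longleftrightarrow> S k t" if "k < t" "0 < \<alpha> k" for k
  proof
    show "S k t" if "a \<le> k"
      using a(2) that \<open>k < t\<close> up[of a t k t] by auto
    show "a \<le> k" if "S k t"
      unfolding a_def by (rule Least_le) (use that \<open>k < t\<close> \<open>0 < \<alpha> k\<close> in \<open>auto simp: supp_def\<close>)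
  qed
  have le_b: "b \<le> k \<longleftrightarrow> S k k" if "k < t" "0 < \<alpha> k" for k
  proof
    show "S k k" if "b \<le> k"
      using b(2) that \<open>k < t\<close> up[of b b k k] by auto
    show "b \<le> k" if "S k k"
      unfolding b_def by (rule Least_le) (use that \<open>k < t\<close> \<open>0 < \<alpha> k\<close> in \<open>auto simp: supp_def\<close>)
  qed
  have "(\<Sum>k<t. \<alpha> k * (of_bool (S k t) + of_bool (S k k))) = step_val t \<alpha> a b"
    unfolding step_val_def
  proof (rule sum.cong)
    fix k assume "k \<in> {..<t}"
    then show "\<alpha> k * (of_bool (S k t) + of_bool (S k k))
        = \<alpha> k * (of_bool (a \<le> k) + of_bool (b \<le> k))"
      using le_a[of k] le_b[of k] nonneg[of k] by (cases "\<alpha> k = 0") auto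
  qed simp
  also have "\<dots> \<le> step_max t S \<alpha>"
    using \<open>a \<le> b\<close> bt \<open>S a b\<close> by (intro step_val_le_max) auto
  finally show "(\<Sum>k<t. \<alpha> k * (of_bool (S k t) + of_bool (S k k))) \<le> step_max t S \<alpha>" .
qed

text \<open>Returning from \<open>\<beta>\<close> to \<open>\<alpha>\<close> raises the value at
  \<open>(i, j)\<close> by \<open>\<epsilon> * n i j\<close>. Pairs in \<open>S\<close> have
  \<open>n i j \<le> 2\<close>, which bounds the increase of the maximum; equality follows because
  some maximiser for \<open>\<beta>\<close> has \<open>n\<close> at least 2.\<close>

lemma step_max_critical:
  assumes nonneg: "\<And>k. k < t \<Longrightarrow> 0 \<le> \<alpha> k"
    and ab: "a < b" "b < t" "S a t" "S b b" "\<not> S a b"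
    and last: "\<And>k. b < k \<Longrightarrow> k < t \<Longrightarrow> 0 < \<alpha> k \<Longrightarrow> S a k"
    and \<epsilon>: "0 \<le> \<epsilon>" "\<epsilon> \<le> \<alpha> a" "\<epsilon> \<le> \<alpha> b"
    and \<beta>: "\<beta> = \<alpha>(a := \<alpha> a - \<epsilon>, b := \<alpha> b - \<epsilon>)"
  shows "step_max t S \<alpha> = step_max t S \<beta> + 2 * \<epsilon>"
proof -
  define n where "n i j = (of_bool (i \<le> a) + of_bool (j \<le> a) + of_bool (i \<le> b) + of_bool (j \<le> b) :: rat)"
    for i j
  have \<alpha>\<beta>: "\<alpha> k = \<beta> k + (if k = a then \<epsilon> else 0) + (if k = b then \<epsilon> else 0)" for k
    using ab(1) by (auto simp: \<beta>)
  have val: "step_val t \<alpha> i j = step_val t \<beta> i j + \<epsilon> * n i j" for i j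
  proof -
    have "step_val t \<alpha> i j = (\<Sum>k<t. \<beta> k * (of_bool (i \<le> k) + of_bool (j \<le> k))
        + (if k = a then \<epsilon> * (of_bool (i \<le> k) + of_bool (j \<le> k)) else 0)
        + (if k = b then \<epsilon> * (of_bool (i \<le> k) + of_bool (j \<le> k)) else 0))"
      unfolding step_val_def by (rule sum.cong) (auto simp: \<alpha>\<beta> algebra_simps)
    also have "\<dots> = step_val t \<beta> i j + \<epsilon> * n i j"
      using ab(1,2) by (simp add: sum.distrib step_val_def n_def algebra_simps)
    finally show ?thesis .
  qed
  have \<beta>_nonneg: "0 \<le> \<beta> k" if "k < t" for k
    using nonneg[OF that] \<epsilon> by (auto simp: \<beta>)
  show ?thesis
  proof (rule antisym)
    obtain i j where ij: "i \<le> j" "j \<le> t" "S i j" "step_max t S \<alpha> = step_val t \<alpha> i j"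
      by (rule step_max_attained)
    \<comment> \<open>With \<open>i \<le> j\<close>, three or more of the four inequalities would
      force \<open>i \<le> a\<close> and \<open>j \<le> b\<close>, hence
      \<open>S a b\<close>.\<close>
    have "n i j \<le> 2"
      using ab ij up[of i j a b] by (auto simp: n_def)
    then have "\<epsilon> * n i j \<le> \<epsilon> * 2"
      using \<epsilon>(1) by (rule mult_left_mono)
    moreover have "step_val t \<beta> i j \<le> step_max t S \<beta>"
      using ij by (intro step_val_le_max) auto
    ultimately show "step_max t S \<alpha> \<le> step_max t S \<beta> + 2 * \<epsilon>"
      unfolding ij(4) val by simp
  next
    obtain i j where ij: "i \<le> j" "j \<le> t" "S i j" "step_max t S \<beta> = step_val t \<beta> i j"
      by (rule step_max_attained)
    have "\<exists>i' j'. i' \<le> t \<and> j' \<le> t \<and> S i' j' \<and> step_val t \<beta> i j \<le> step_val t \<beta> i' j' \<and> 2 \<le> n i' j'"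
    proof (cases "i \<le> a \<or> j \<le> b")
      case True
      then have "2 \<le> n i j"
        using ab(1) ij(1) by (auto simp: n_def)
      then show ?thesis
        using ij by (intro exI[of _ i] exI[of _ j]) auto
    next
      case False
      \<comment> \<open>The pair \<open>(i, j)\<close> gains at most \<open>\<epsilon>\<close>, but \<open>(a, j')\<close> gains \<open>2 \<epsilon>\<close> and is at least as good.\<close>
      define supp where "supp k \<longleftrightarrow> j \<le> k \<and> (k = t \<or> k < t \<and> 0 < \<alpha> k)" for k
      define j' where "j' = (LEAST k. supp k)"
      have j': "supp j'"
        unfolding j'_def by (rule LeastI[of _ t]) (use ij in \<open>auto simp: supp_def\<close>)
      \<comment> \<open>Since \<open>b < j \<le> j'\<close>, either \<open>j' = t\<close> and
        \<open>S a t\<close> applies, or \<open>j'\<close> has positive weight and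
        \<open>last\<close> applies.\<close>
      have "S a j'"
        using j' False ab(3) last[of j'] by (auto simp: supp_def)
      \<comment> \<open>Steps from \<open>j\<close> up to but excluding \<open>j'\<close> have
        weight zero, so moving \<open>j\<close> to \<open>j'\<close> costs nothing, and lowering
        \<open>i\<close> to \<open>a\<close> loses nothing.\<close>
      moreover have "step_val t \<beta> i j \<le> step_val t \<beta> a j'"
        unfolding step_val_def
      proof (rule sum_mono)
        fix k assume "k \<in> {..<t}"
        then have k: "k < t" by simp
        show "\<beta> k * (of_bool (i \<le> k) + of_bool (j \<le> k)) \<le> \<beta> k * (of_bool (a \<le> k) + of_bool (j' \<le> k))"
        proof (cases "\<beta> k = 0")
          case nz: False
          then have "0 < \<alpha> k"
            using \<beta>_nonneg[OF k] \<alpha>\<beta>[of k] \<epsilon>(1) by (auto split: if_splits)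
          then have "j' \<le> k" if "j \<le> k"
            unfolding j'_def using that k by (intro Least_le) (auto simp: supp_def)
          then show ?thesis
            using False \<beta>_nonneg[OF k] by (intro mult_left_mono) auto
        qed simp
      qed
      moreover have "2 \<le> n a j'"
        using ab(1) by (auto simp: n_def)
      ultimately show ?thesis
        using j' ab by (intro exI[of _ a] exI[of _ j']) (auto simp: supp_def)
    qed
    then obtain i' j' where ij': "i' \<le> t" "j' \<le> t" "S i' j'"
      "step_val t \<beta> i j \<le> step_val t \<beta> i' j'" "2 \<le> n i' j'"
      by blast
    have "\<epsilon> * 2 \<le> \<epsilon> * n i' j'"
      using ij'(5) \<epsilon>(1) by (rule mult_left_mono)
    then have "step_max t S \<beta> + 2 * \<epsilon> \<le> step_val t \<alpha> i' j'"
      using ij'(4) by (simp add: val ij(4))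
    also have "\<dots> \<le> step_max t S \<alpha>"
      using ij' by (intro step_val_le_max)
    finally show "step_max t S \<beta> + 2 * \<epsilon> \<le> step_max t S \<alpha>" .
  qed
qed

text \<open>\<open>K\<close> will be the set of positive or of nonnegative rationals.\<close>

lemma reduction_to_pairs:
  fixes D :: rat and q :: "nat \<Rightarrow> rat"
  assumes K_add: "\<And>x y. x \<in> K \<Longrightarrow> y \<in> K \<Longrightarrow> x + y \<in> K"
    and single: "\<And>k \<epsilon>. k < t \<Longrightarrow> 0 < \<epsilon> \<Longrightarrow>
      \<epsilon> * q k + D * (\<epsilon> * (of_bool (S k t) + of_bool (S k k))) \<in> K"
    and pair: "\<And>a b \<epsilon>. a < b \<Longrightarrow> b < t \<Longrightarrow> 0 < \<epsilon> \<Longrightarrow> S a t \<Longrightarrow> S b b \<Longrightarrow> \<not> S a b \<Longrightarrow>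
      \<epsilon> * q a + \<epsilon> * q b + D * (2 * \<epsilon>) \<in> K"
    and nonneg: "\<And>k. k < t \<Longrightarrow> 0 \<le> \<alpha> k"
    and pos: "\<exists>k<t. 0 < \<alpha> k"
  shows "(\<Sum>k<t. \<alpha> k * q k) + D * step_max t S \<alpha> \<in> K"
  using nonneg pos
\<comment> \<open>The chain stays fixed and steps are removed by letting their weight become zero;
  the induction counts the remaining positive weights.\<close>
proof (induction "card {k. k < t \<and> 0 < \<alpha> k}" arbitrary: \<alpha> rule: less_induct)
  case less
  define T where "T = {k. k < t \<and> 0 < \<alpha> k}"
  have T: "finite T" "T \<noteq> {}"
    using less.prems(2) by (auto simp: T_def)
  show ?case
  proof (cases "\<exists>a b. a \<in> T \<and> b \<in> T \<and> a < b \<and> S a t \<and> S b b \<and> \<not> S a b")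
    case False
    have "step_max t S \<alpha> = (\<Sum>k<t. \<alpha> k * (of_bool (S k t) + of_bool (S k k)))"
      using False less.prems(1) by (intro step_max_noncritical) (force simp: T_def)+
    then have "(\<Sum>k<t. \<alpha> k * q k) + D * step_max t S \<alpha>
        = (\<Sum>k<t. \<alpha> k * q k + D * (\<alpha> k * (of_bool (S k t) + of_bool (S k k))))"
      by (simp add: sum.distrib sum_distrib_left)
    \<comment> \<open>Zero weights must be dropped first: for strict inequality \<open>0\<close> is
      not in \<open>K\<close>, so only a nonempty sum of terms in \<open>K\<close> can be
      used.\<close>
    also have "\<dots> = (\<Sum>k\<in>T. \<alpha> k * q k + D * (\<alpha> k * (of_bool (S k t) + of_bool (S k k))))"
      using less.prems(1) by (intro sum.mono_neutral_right) (force simp: T_def)+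
    also have "\<dots> \<in> K"
    proof -
      have "(\<Sum>k\<in>A. \<alpha> k * q k + D * (\<alpha> k * (of_bool (S k t) + of_bool (S k k)))) \<in> K"
        if "finite A" "A \<noteq> {}" "A \<subseteq> T" for A
        using that
      proof (induction A rule: finite_ne_induct)
        case (singleton k)
        then show ?case using single[of k "\<alpha> k"] by (simp add: T_def)
      next
        case (insert k A)
        then have "\<alpha> k * q k + D * (\<alpha> k * (of_bool (S k t) + of_bool (S k k))) \<in> K"
          by (intro single) (auto simp: T_def)
        then show ?case using insert K_add by simp
      qed
      then show ?thesis using T by blast
    qed
    finally show ?thesis .
  next
    case True
    then obtain a b0 where a: "a \<in> T" "S a t" and b0: "b0 \<in> T" "a < b0" "S b0 b0" "\<not> S a b0"
      by blast
    \<comment> \<open>Taking the last position of positive weight at which \<open>S a\<close> fails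
      supplies the hypothesis \<open>last\<close> of \<open>step_max_critical\<close>;
      \<open>S b b\<close> is inherited from \<open>b0 \<le> b\<close>.\<close>
    define b where "b = Max {b \<in> T. \<not> S a b}"
    have "b \<in> {b \<in> T. \<not> S a b}"
      unfolding b_def by (rule Max_in) (use T b0 in auto)
    then have b: "b \<in> T" "\<not> S a b" by auto
    have b_max: "k \<le> b" if "k \<in> T" "\<not> S a k" for k
      unfolding b_def by (rule Max_ge) (use T that in auto)
    have "b0 \<le> b" by (rule b_max) (use b0 in auto)
    then have ab: "a < b" "b < t" "S b b"
      using b0 b up[of b0 b0 b b] by (auto simp: T_def)
    \<comment> \<open>The largest amount that keeps both weights nonnegative; it kills at least one
      of them, so the induction measure drops.\<close>
    define \<epsilon> where "\<epsilon> = min (\<alpha> a) (\<alpha> b)"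
    define \<beta> where "\<beta> = \<alpha>(a := \<alpha> a - \<epsilon>, b := \<alpha> b - \<epsilon>)"
    have \<epsilon>: "0 < \<epsilon>" "\<epsilon> \<le> \<alpha> a" "\<epsilon> \<le> \<alpha> b"
      using a b by (auto simp: \<epsilon>_def T_def)
    have max: "step_max t S \<alpha> = step_max t S \<beta> + 2 * \<epsilon>"
      using less.prems(1) ab a b \<epsilon> b_max
      by (intro step_max_critical[where a = a and b = b]) (force simp: \<beta>_def T_def)+
    have "(\<Sum>k<t. \<alpha> k * q k) = (\<Sum>k<t. \<beta> k * q k + (if k = a then \<epsilon> * q k else 0)
        + (if k = b then \<epsilon> * q k else 0))"
      using ab(1) by (intro sum.cong) (auto simp: \<beta>_def algebra_simps)
    also have "\<dots> = (\<Sum>k<t. \<beta> k * q k) + (\<epsilon> * q a + \<epsilon> * q b)"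
      using ab by (simp add: sum.distrib)
    finally have split: "(\<Sum>k<t. \<alpha> k * q k) + D * step_max t S \<alpha>
        = ((\<Sum>k<t. \<beta> k * q k) + D * step_max t S \<beta>) + (\<epsilon> * q a + \<epsilon> * q b + D * (2 * \<epsilon>))"
      by (simp add: max algebra_simps)
    have pair': "\<epsilon> * q a + \<epsilon> * q b + D * (2 * \<epsilon>) \<in> K"
      using ab a b \<epsilon> by (intro pair) auto
    have \<beta>_nonneg: "0 \<le> \<beta> k" if "k < t" for k
      using less.prems(1)[OF that] \<epsilon> by (auto simp: \<beta>_def)
    show ?thesis
    \<comment> \<open>If nothing of positive weight remains, the remainder is \<open>0\<close>,
      possibly outside \<open>K\<close>, and the pair term alone is the whole value.\<close>
    proof (cases "\<exists>k<t. 0 < \<beta> k")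
      case True
      have "{k. k < t \<and> 0 < \<beta> k} \<subset> T"
      proof
        show "{k. k < t \<and> 0 < \<beta> k} \<subseteq> T"
          using a b by (auto simp: \<beta>_def T_def split: if_splits)
        have "\<beta> a = 0 \<or> \<beta> b = 0"
          using ab(1) by (auto simp: \<beta>_def \<epsilon>_def min_def)
        then show "{k. k < t \<and> 0 < \<beta> k} \<noteq> T"
          using a b by auto
      qed
      then have "(\<Sum>k<t. \<beta> k * q k) + D * step_max t S \<beta> \<in> K"
        using less.hyps[of \<beta>] \<beta>_nonneg True T by (simp add: T_def psubset_card_mono)
      then show ?thesis
        unfolding split using pair' K_add by blast
    next
      case False
      then have zero: "\<beta> k = 0" if "k < t" for k
        using \<beta>_nonneg[OF that] that by force
      obtain i j where "step_max t S \<beta> = step_val t \<beta> i j"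
        using step_max_attained by metis
      then have "step_max t S \<beta> = 0"
        by (simp add: step_val_def zero)
      then show ?thesis
        unfolding split using pair' by (simp add: zero)
    qed
  qed
qed

end

section \<open>Ranks of subbundles\<close>

lemma frame_on_basis:
  assumes "frame_on sc F U es" "y \<in> U"
  obtains B where "finite B" "\<not> module.dependent sc B" "module.span sc B = F y"
  using assms that[of "(\<lambda>e. e y) ` set es"] by (auto simp: frame_on_def)

lemma vector_bundle_fibre_basis:
  assumes "vector_bundle X E" "x \<in> X"
  obtains B where "finite B" "\<not> module.dependent (vscale E) B" "module.span (vscale E) B = fibre E x"
proof -
  obtain V es where "(V, es) \<in> atlas E" "x \<in> V"
    using assms by (auto simp: vector_bundle_def)
  moreover from this have "frame_on (vscale E) (fibre E) V es"
    using assms(1) by (auto simp: vector_bundle_def)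
  ultimately show thesis
    using that by (auto elim: frame_on_basis)
qed

lemma vb_rank_eq_dim:
  assumes "vector_bundle X E" "x \<in> X"
  shows "vector_space.dim (vscale E) (fibre E x) = vb_rank X E"
proof -
  obtain r where r: "\<forall>x\<in>X. vector_space.dim (vscale E) (fibre E x) = r"
    using assms(1) by (auto simp: vector_bundle_def)
  then have "vb_rank X E = r"
    unfolding vb_rank_def using assms(2) by (intro the_equality) auto
  then show ?thesis using r assms(2) by simp
qed

text \<open>The rank is constant on \<open>X\<close>, so a single point where the fibres differ
  suffices: a basis of the smaller fibre there extends by a vector of the larger one.\<close>

lemma vb_rank_strict_mono:
  fixes E G :: "((complex ^ 'n) set, 'v::ab_group_add) vbundle"
  assumes E: "vector_bundle X E" and G: "vector_bundle X G" and sc: "vscale G = vscale E"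
    and less: "subbundle_less X (fibre E) (fibre G)"
  shows "vb_rank X E < vb_rank X G"
proof -
  interpret vector_space "vscale E"
    using E by (simp add: vector_bundle_def)
  obtain x where x: "x \<in> X" "fibre E x \<subset> fibre G x"
    using less by (auto simp: subbundle_less_def)
  obtain B where B: "finite B" "independent B" "span B = fibre E x"
    using vector_bundle_fibre_basis[OF E x(1)] by metis
  obtain C where C: "finite C" "independent C" "span C = fibre G x"
    using vector_bundle_fibre_basis[OF G x(1)] sc by metis
  obtain v where v: "v \<in> fibre G x" "v \<notin> span B"
    using x(2) B(3) by blast
  have "independent (insert v B)"
    using v(2) B(2) by (simp add: independent_insert)
  moreover have "insert v B \<subseteq> span C"
    using v(1) x(2) B(3) C(3) span_superset by fastforce
  ultimately have "card (insert v B) \<le> card C"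
    using independent_span_bound[OF C(1)] by blast
  then have "card B < card C"
    using B(1) v(2) span_superset by (metis card_insert_disjoint less_eq_Suc_le subsetD)
  moreover have "vb_rank X E = card B"
    using vb_rank_eq_dim[OF E x(1)] B dim_span dim_eq_card_independent by metis
  moreover have "vb_rank X G = card C"
    using vb_rank_eq_dim[OF G x(1)] C sc dim_span dim_eq_card_independent by metis
  ultimately show ?thesis by simp
qed

section \<open>Products of subbundles\<close>

lemma vector_space_fscale: "vector_space fscale"
  by unfold_locales (auto simp: fscale_def fun_eq_iff algebra_simps)

lemma sym_prod_commute: "sym_prod sc v w = sym_prod sc w v"
  by (auto simp: sym_prod_def mult.commute)

lemma sym_prod_right_linear:
  assumes "vector_space sc"
  shows "sym_prod sc v (w + w') = sym_prod sc v w + sym_prod sc v w'"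
    and "sym_prod sc v (sc c w) = fscale c (sym_prod sc v w)"
    and "sym_prod sc v 0 = 0"
proof -
  show "sym_prod sc v (w + w') = sym_prod sc v w + sym_prod sc v w'"
    by (auto simp: sym_prod_def fun_eq_iff Vector_Spaces.linear_iff algebra_simps)
  show "sym_prod sc v (sc c w) = fscale c (sym_prod sc v w)"
    by (auto simp: sym_prod_def fun_eq_iff Vector_Spaces.linear_iff fscale_def)
  show "sym_prod sc v 0 = 0"
    by (auto simp: sym_prod_def fun_eq_iff Vector_Spaces.linear_iff) (metis add_cancel_right_right)
qed

text \<open>Linearity in the right factor, applied once to each factor with the help of
  commutativity, expands the product over the generators.\<close>

lemma sym_prod_in_span:
  assumes sc: "vector_space sc" and "v \<in> module.span sc A" "w \<in> module.span sc A"
  shows "sym_prod sc v w \<in> module.span fscale {sym_prod sc a b | a b. a \<in> A \<and> b \<in> A}"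
    (is "_ \<in> ?S")
proof -
  interpret V: vector_space sc by (rule sc)
  interpret F: vector_space fscale by (rule vector_space_fscale)
  have right: "sym_prod sc u z \<in> ?S"
    if u: "\<And>a. a \<in> A \<Longrightarrow> sym_prod sc u a \<in> ?S" and z: "z \<in> V.span A" for u z
    using z
  proof (induction z rule: V.span_induct_alt)
    case base
    show ?case unfolding sym_prod_right_linear(3)[OF sc] by (rule F.span_zero)
  next
    case (step c x y)
    then show ?case
      unfolding sym_prod_right_linear[OF sc] by (intro F.span_add F.span_scale) (use step u in auto)
  qed
  have "sym_prod sc w a \<in> ?S" if "a \<in> A" for a
  proof -
    have "sym_prod sc a w \<in> ?S"
      by (rule right) (use that assms(3) in \<open>auto intro: F.span_base\<close>)
    then show ?thesis by (simp add: sym_prod_commute)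
  qed
  then have "sym_prod sc w v \<in> ?S"
    using right assms(2) by blast
  then show ?thesis by (simp add: sym_prod_commute)
qed

lemma zopen_subset: "zopen X U \<Longrightarrow> U \<subseteq> X"
  by (metis Int_iff openin_subset subsetD subsetI topspace_subtopology)

lemma sub_prod_commute: "sub_prod X E A B = sub_prod X E B A"
proof -
  interpret F: vector_space fscale by (rule vector_space_fscale)
  have "sub_prod X E A B x \<subseteq> sub_prod X E B A x" for A B x
    unfolding sub_prod_def
  proof (intro F.span_mono subsetI, elim CollectE exE conjE)
    fix u a b U
    assume "u = sym_prod (vscale E) (a x) (b x)" "x \<in> U"
      "regular_section X E U a" "\<forall>y\<in>U. a y \<in> A y" "regular_section X E U b" "\<forall>y\<in>U. b y \<in> B y"
    then show "u \<in> {sym_prod (vscale E) (a x) (b x) | a b U. x \<in> U \<and>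
        regular_section X E U a \<and> (\<forall>y\<in>U. a y \<in> B y) \<and>
        regular_section X E U b \<and> (\<forall>y\<in>U. b y \<in> A y)}"
      by - (rule CollectI, rule exI[of _ b], rule exI[of _ a], rule exI[of _ U],
        simp add: sym_prod_commute[of _ "a x"])
  qed
  then show ?thesis by (simp add: fun_eq_iff subset_antisym)
qed

lemma sub_prod_mono:
  assumes "\<And>x. x \<in> X \<Longrightarrow> A x \<subseteq> A' x" "\<And>x. x \<in> X \<Longrightarrow> B x \<subseteq> B' x"
  shows "sub_prod X E A B x \<subseteq> sub_prod X E A' B' x"
proof -
  interpret F: vector_space fscale by (rule vector_space_fscale)
  \<comment> \<open>Regular sections live on open subsets of \<open>X\<close>, so inclusions known
    only at points of \<open>X\<close> apply to all their values.\<close>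
  have "U \<subseteq> X" if "regular_section X E U a" for U a
    using that zopen_subset by (auto simp: regular_section_def)
  then have "(\<forall>y\<in>U. a y \<in> A' y) \<and> (\<forall>y\<in>U. b y \<in> B' y)"
    if "regular_section X E U a" "\<forall>y\<in>U. a y \<in> A y" "\<forall>y\<in>U. b y \<in> B y" for U a b
    using that assms by (meson subsetD)
  then show ?thesis
    unfolding sub_prod_def by (intro F.span_mono Collect_mono) metis
qed

text \<open>Fibres of \<open>Sym2 E\<close> are spanned by products of arbitrary vectors,
  \<open>sub_prod\<close> by values of products of local sections. A local frame bridges the two,
  since its values span the fibre. This yields \<open>S t t\<close> for the staircase.\<close>

lemma Sym2_fibre_subset_sub_prod:
  assumes E: "vector_bundle X E" and x: "x \<in> X"
  shows "fibre (Sym2 E) x \<subseteq> sub_prod X E (fibre E) (fibre E) x"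
proof -
  interpret F: vector_space fscale by (rule vector_space_fscale)
  have sc: "vector_space (vscale E)"
    using E by (simp add: vector_bundle_def)
  obtain V es where Ves: "(V, es) \<in> atlas E" "x \<in> V"
    using E x by (auto simp: vector_bundle_def)
  then have frame: "frame_on (vscale E) (fibre E) V es" "\<And>e. e \<in> set es \<Longrightarrow> regular_section X E V e"
    using E by (auto simp: vector_bundle_def)
  let ?A = "(\<lambda>e. e x) ` set es"
  have "sym_prod (vscale E) a b \<in> sub_prod X E (fibre E) (fibre E) x" if ab: "a \<in> ?A" "b \<in> ?A" for a b
  proof -
    obtain e e' where e: "e \<in> set es" "e' \<in> set es" "a = e x" "b = e' x"
      using ab by blast
    then have reg: "regular_section X E V e" "regular_section X E V e'"
      using frame(2) by auto
    then have "\<forall>y\<in>V. e y \<in> fibre E y" "\<forall>y\<in>V. e' y \<in> fibre E y"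
      by (simp_all add: regular_section_def)
    then show ?thesis
      unfolding sub_prod_def e(3,4)
      by - (rule F.span_base, rule CollectI, rule exI[of _ e], rule exI[of _ e'], rule exI[of _ V],
        use reg Ves(2) in simp)
  qed
  then have "{sym_prod (vscale E) a b | a b. a \<in> ?A \<and> b \<in> ?A} \<subseteq> sub_prod X E (fibre E) (fibre E) x"
    by blast
  then have "F.span {sym_prod (vscale E) a b | a b. a \<in> ?A \<and> b \<in> ?A}
      \<subseteq> sub_prod X E (fibre E) (fibre E) x"
    unfolding sub_prod_def by (intro F.span_minimal F.subspace_span)
  moreover have "module.span (vscale E) ?A = fibre E x"
    using frame(1) Ves(2) by (auto simp: frame_on_def)
  ultimately have "sym_prod (vscale E) v w \<in> sub_prod X E (fibre E) (fibre E) x"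
    if "v \<in> fibre E x" "w \<in> fibre E x" for v w
    using sym_prod_in_span[OF sc, of v ?A w] that by (simp only: subsetD)
  then have "{sym_prod (vscale E) v w | v w. v \<in> fibre E x \<and> w \<in> fibre E x}
      \<subseteq> sub_prod X E (fibre E) (fibre E) x"
    by blast
  then show ?thesis
    unfolding Sym2_def sub_prod_def by (simp add: F.span_minimal F.subspace_span)
qed

lemma nonzero_on_mono: "nonzero_on X Q S \<Longrightarrow> (\<And>x. x \<in> X \<Longrightarrow> S x \<subseteq> T x) \<Longrightarrow> nonzero_on X Q T"
  unfolding nonzero_on_def by blast

section \<open>The semistability function of a weighted filtration\<close>

text \<open>List positions as in \<open>filt_mu\<close>: position \<open>length Fs\<close> is \<open>E\<close> itself.\<close>

definition filt_support where
  "filt_support X E Q Fs i j \<longleftrightarrow>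
     nonzero_on X Q (sub_prod X E ((Fs @ [fibre E]) ! i) ((Fs @ [fibre E]) ! j))"

text \<open>The coefficient of the weight of the step \<open>F\<close> in the linear part of
  \<open>P + \<delta> \<mu>\<close>: the last term comes from the summand \<open>2 * s\<close> in
  the sums of two entries of gamma.\<close>

definition sub_weight where
  "sub_weight X E \<delta> F =
     of_int (vb_degree X E) * of_nat (vb_rank X (sub_vb X E F))
     - of_nat (vb_rank X E) * of_int (vb_degree X (sub_vb X E F))
     - 2 * \<delta> * (of_nat (vb_rank X (sub_vb X E F)) :: rat)"

lemma weighted_filtration_nth_less:
  assumes "weighted_filtration X E Fs \<alpha>s" "i < j" "j \<le> length Fs"
  shows "subbundle_less X ((Fs @ [fibre E]) ! i) ((Fs @ [fibre E]) ! j)"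
proof -
  have "sorted_wrt (subbundle_less X) (Fs @ [fibre E])"
    using assms(1) by (simp add: weighted_filtration_def)
  then show ?thesis
    by (rule sorted_wrt_nth_less) (use assms(2,3) in auto)
qed

lemma weighted_filtration_nth_subset:
  assumes "weighted_filtration X E Fs \<alpha>s" "i \<le> j" "j \<le> length Fs" "x \<in> X"
  shows "((Fs @ [fibre E]) ! i) x \<subseteq> ((Fs @ [fibre E]) ! j) x"
  using weighted_filtration_nth_less[OF assms(1), of i j] assms
  by (cases "i = j") (auto simp: subbundle_less_def)

lemma staircase_filt_support:
  assumes "quadric_bundle X N E Q" and wf: "weighted_filtration X E Fs \<alpha>s"
  shows "staircase (length Fs) (filt_support X E Q Fs)"
proof
  show "filt_support X E Q Fs j i" if "filt_support X E Q Fs i j" for i j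
    using that unfolding filt_support_def by (subst sub_prod_commute)
  show "filt_support X E Q Fs i' j'"
    if "filt_support X E Q Fs i j" "i \<le> i'" "j \<le> j'" "i' \<le> length Fs" "j' \<le> length Fs" for i j i' j'
    using that(1) unfolding filt_support_def
    by (rule nonzero_on_mono) (intro sub_prod_mono weighted_filtration_nth_subset[OF wf] that)
  show "filt_support X E Q Fs (length Fs) (length Fs)"
    using assms(1) Sym2_fibre_subset_sub_prod[of X E]
    by (auto simp: filt_support_def quadric_bundle_def intro: nonzero_on_mono)
qed

lemma filt_rank_strict_mono:
  assumes E: "vector_bundle X E" and wf: "weighted_filtration X E Fs \<alpha>s"
    and "i < j" "j \<le> length Fs"
  shows "filt_rank X E Fs i < filt_rank X E Fs j"
proof -
  define G where "G = Fs @ [fibre E]"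
  have sub: "vector_bundle X (sub_vb X E F)" if "F \<in> set Fs" for F
    using wf that by (auto simp: weighted_filtration_def subbundle_def)
  have less: "subbundle_less X (Fs ! i) (G ! j)"
    using weighted_filtration_nth_less[OF wf assms(3,4)] assms(3,4) by (simp add: G_def nth_append)
  show ?thesis
  proof (cases "j < length Fs")
    case True
    then show ?thesis
      using less assms(3) sub
      by (auto simp: filt_rank_def G_def nth_append sub_vb_def intro!: vb_rank_strict_mono)
  next
    case False
    then show ?thesis
      using less assms(3,4) sub E
      by (auto simp: filt_rank_def G_def nth_append sub_vb_def intro!: vb_rank_strict_mono)
  qed
qed

text \<open>The entry of gamma belonging to position \<open>i\<close> is
  \<open>s - r * (\<Sum>k<t. \<alpha>s ! k * of_bool (i \<le> k))\<close>, so minus the minimum of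
  \<open>2 * s - r * step_val\<close> is \<open>r\<close> times the maximum of
  \<open>step_val\<close>, minus \<open>2 * s\<close>.\<close>

lemma filt_mu_eq:
  assumes Q: "quadric_bundle X N E Q" and wf: "weighted_filtration X E Fs \<alpha>s"
  shows "filt_mu X E Q Fs \<alpha>s =
    of_nat (vb_rank X E) * step_max (length Fs) (filt_support X E Q Fs) ((!) \<alpha>s)
    - 2 * (\<Sum>k<length Fs. \<alpha>s ! k * of_nat (vb_rank X (sub_vb X E (Fs ! k))))"
proof -
  define t where "t = length Fs"
  define r where "r = (of_nat (vb_rank X E) :: rat)"
  define s where "s = (\<Sum>k<t. \<alpha>s ! k * of_nat (vb_rank X (sub_vb X E (Fs ! k))))"
  interpret staircase t "filt_support X E Q Fs"
    unfolding t_def using Q wf by (rule staircase_filt_support)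
  have E: "vector_bundle X E"
    using Q by (simp add: quadric_bundle_def)
  \<comment> \<open>Ranks grow strictly along the chain, so the case distinction in
    \<open>filt_gamma\<close> becomes a comparison of positions.\<close>
  have rank_le: "filt_rank X E Fs i \<le> filt_rank X E Fs k \<longleftrightarrow> i \<le> k" if "i \<le> t" "k < t" for i k
    using filt_rank_strict_mono[OF E wf, of i k] filt_rank_strict_mono[OF E wf, of k i] that
    by (cases i k rule: linorder_cases) (auto simp: t_def)
  have gamma: "filt_gamma X E Fs \<alpha>s (filt_rank X E Fs i)
      = s - r * (\<Sum>k<t. \<alpha>s ! k * of_bool (i \<le> k))" if "i \<le> t" for i
  proof -
    have "filt_gamma X E Fs \<alpha>s (filt_rank X E Fs i)
        = (\<Sum>k<t. \<alpha>s ! k * of_nat (vb_rank X (sub_vb X E (Fs ! k))) - r * (\<alpha>s ! k * of_bool (i \<le> k)))"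
      unfolding filt_gamma_def t_def[symmetric]
      by (rule sum.cong) (use rank_le[OF that] in \<open>auto simp: filt_rank_def t_def r_def algebra_simps\<close>)
    then show ?thesis
      by (simp only: s_def sum_subtractf sum_distrib_left)
  qed
  have val: "filt_gamma X E Fs \<alpha>s (filt_rank X E Fs i) + filt_gamma X E Fs \<alpha>s (filt_rank X E Fs j)
      = 2 * s - r * step_val t ((!) \<alpha>s) i j" if "i \<le> t" "j \<le> t" for i j
    using that by (simp add: gamma step_val_def sum.distrib algebra_simps)
  obtain i j where ij: "i \<le> j" "j \<le> t" "filt_support X E Q Fs i j"
    "step_max t (filt_support X E Q Fs) ((!) \<alpha>s) = step_val t ((!) \<alpha>s) i j"
    by (rule step_max_attained)
  have "Min {filt_gamma X E Fs \<alpha>s (filt_rank X E Fs i) + filt_gamma X E Fs \<alpha>s (filt_rank X E Fs j) | i j.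
      i \<le> t \<and> j \<le> t \<and> filt_support X E Q Fs i j}
    = 2 * s - r * step_max t (filt_support X E Q Fs) ((!) \<alpha>s)"
  proof (rule Min_eqI[OF finite_pairs_image])
    show "2 * s - r * step_max t (filt_support X E Q Fs) ((!) \<alpha>s) \<le> y"
      if "y \<in> {filt_gamma X E Fs \<alpha>s (filt_rank X E Fs i) + filt_gamma X E Fs \<alpha>s (filt_rank X E Fs j) | i j.
        i \<le> t \<and> j \<le> t \<and> filt_support X E Q Fs i j}" for y
      using that by (auto simp: val r_def intro!: mult_left_mono step_val_le_max)
    show "2 * s - r * step_max t (filt_support X E Q Fs) ((!) \<alpha>s)
      \<in> {filt_gamma X E Fs \<alpha>s (filt_rank X E Fs i) + filt_gamma X E Fs \<alpha>s (filt_rank X E Fs j) | i j.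
        i \<le> t \<and> j \<le> t \<and> filt_support X E Q Fs i j}"
      using ij val[of i j] by (smt (verit) mem_Collect_eq order_trans)
  qed
  then show ?thesis
    by (simp add: filt_mu_def filt_support_def t_def r_def s_def)
qed

lemma filt_P_plus_mu_eq:
  assumes "quadric_bundle X N E Q" and "weighted_filtration X E Fs \<alpha>s"
  shows "filt_P X E Fs \<alpha>s + \<delta> * filt_mu X E Q Fs \<alpha>s =
    (\<Sum>k<length Fs. \<alpha>s ! k * sub_weight X E \<delta> (Fs ! k))
    + \<delta> * of_nat (vb_rank X E) * step_max (length Fs) (filt_support X E Q Fs) ((!) \<alpha>s)"
  unfolding filt_mu_eq[OF assms] filt_P_def sub_weight_def
  by (simp add: algebra_simps sum_subtractf sum.distrib sum_distrib_left)

section \<open>Subfiltrations of length one and two, and criticality\<close>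

lemma weighted_filtration_pair:
  assumes wf: "weighted_filtration X E Fs \<alpha>s"
    and "a < b" "b < length Fs" "0 < \<epsilon>" "0 < \<epsilon>'"
  shows "weighted_filtration X E [Fs ! a, Fs ! b] [\<epsilon>, \<epsilon>']"
proof -
  have "subbundle_less X (Fs ! a) (Fs ! b)"
    using weighted_filtration_nth_less[OF wf, of a b] assms by (simp add: nth_append)
  then show ?thesis
    using assms by (auto simp: weighted_filtration_def sorted_wrt_append)
qed

lemma weighted_filtration_single:
  assumes "weighted_filtration X E Fs \<alpha>s" "a < length Fs" "0 < \<epsilon>"
  shows "weighted_filtration X E [Fs ! a] [\<epsilon>]"
  using assms by (auto simp: weighted_filtration_def sorted_wrt_append)

lemma step_max_single:
  assumes "quadric_bundle X N E Q" and wf: "weighted_filtration X E [F] [\<epsilon>]"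
  shows "step_max 1 (filt_support X E Q [F]) ((!) [\<epsilon>])
    = \<epsilon> * (of_bool (filt_support X E Q [F] 0 1) + of_bool (filt_support X E Q [F] 0 0))"
proof -
  interpret staircase 1 "filt_support X E Q [F]"
    using staircase_filt_support[OF assms] by simp
  have "0 < \<epsilon>" using wf by (simp add: weighted_filtration_def)
  \<comment> \<open>With a single step there are no \<open>a < b < 1\<close>, so the condition on
    pairs is vacuous.\<close>
  then show ?thesis by (subst step_max_noncritical) auto
qed

text \<open>Subtracting the full weight \<open>\<epsilon>\<close> from both steps leaves zero
  weights, whose maximum is \<open>0\<close>.\<close>

lemma step_max_critical_pair:
  assumes "quadric_bundle X N E Q" and wf: "weighted_filtration X E [F, G] [\<epsilon>, \<epsilon>]"
    and S: "filt_support X E Q [F, G] 0 2" "filt_support X E Q [F, G] 1 1"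
      "\<not> filt_support X E Q [F, G] 0 1"
  shows "step_max 2 (filt_support X E Q [F, G]) ((!) [\<epsilon>, \<epsilon>]) = 2 * \<epsilon>"
proof -
  interpret staircase 2 "filt_support X E Q [F, G]"
    using staircase_filt_support[OF assms(1,2)] by (simp add: numeral_2_eq_2)
  have \<epsilon>: "0 < \<epsilon>" using wf by (simp add: weighted_filtration_def)
  define \<beta> where "\<beta> = ((!) [\<epsilon>, \<epsilon>])(0 := 0, 1 := 0)"
  have zero: "\<beta> k = 0" if "k < 2" for k
    using that by (auto simp: \<beta>_def less_2_cases_iff)
  have "step_max 2 (filt_support X E Q [F, G]) ((!) [\<epsilon>, \<epsilon>])
      = step_max 2 (filt_support X E Q [F, G]) \<beta> + 2 * \<epsilon>"
    by (rule step_max_critical[where a = 0 and b = 1])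
      (use \<epsilon> S in \<open>auto simp: \<beta>_def less_2_cases_iff\<close>)
  moreover have "step_max 2 (filt_support X E Q [F, G]) \<beta> = 0"
    by (subst step_max_noncritical) (simp_all add: zero)
  ultimately show ?thesis by simp
qed

text \<open>Writing \<open>r\<close> for the rank of \<open>E\<close>, the parts of mu linear in the
  ranks of \<open>F\<close> and \<open>G\<close> agree on both sides of the definition of
  \<open>critical\<close>. The remaining parts are \<open>2 * r * \<epsilon>\<close> for the pair,
  against \<open>r * \<epsilon>\<close> for \<open>F\<close> plus \<open>2 * r * \<epsilon>\<close>
  for \<open>G\<close>.\<close>

lemma critical_pair:
  assumes Q: "quadric_bundle X N E Q" and wf: "weighted_filtration X E [F, G] [\<epsilon>, \<epsilon>]"
    and S: "filt_support X E Q [F, G] 0 2" "filt_support X E Q [F, G] 1 1"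
      "\<not> filt_support X E Q [F, G] 0 1"
  shows "critical X E Q [F, G] [\<epsilon>, \<epsilon>]"
proof -
  have wf1: "weighted_filtration X E [F] [\<epsilon>]" "weighted_filtration X E [G] [\<epsilon>]"
    using wf weighted_filtration_single[OF wf, of 0 \<epsilon>] weighted_filtration_single[OF wf, of 1 \<epsilon>]
    by (auto simp: weighted_filtration_def)
  interpret staircase 2 "filt_support X E Q [F, G]"
    using staircase_filt_support[OF assms(1,2)] by (simp add: numeral_2_eq_2)
  \<comment> \<open>If \<open>Q\<close> were nonzero on the product of \<open>F\<close> with itself,
    it would be nonzero on that of \<open>F\<close> and \<open>G\<close>.\<close>
  have F: "filt_support X E Q [F] 0 1" "\<not> filt_support X E Q [F] 0 0"
    using S up[of 0 0 0 1] by (auto simp: filt_support_def)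
  have G: "filt_support X E Q [G] 0 1" "filt_support X E Q [G] 0 0"
    using S up[of 1 1 1 2] by (auto simp: filt_support_def)
  have \<epsilon>: "0 < \<epsilon>" using wf by (simp add: weighted_filtration_def)
  have r: "0 < vb_rank X E"
    using filt_rank_strict_mono[OF _ wf1(1), of 0 1] Q by (simp add: quadric_bundle_def filt_rank_def)
  have "filt_mu X E Q [F] [\<epsilon>]
      = of_nat (vb_rank X E) * \<epsilon> - 2 * \<epsilon> * of_nat (vb_rank X (sub_vb X E F))"
    using step_max_single[OF Q wf1(1)] F by (simp add: filt_mu_eq[OF Q wf1(1)])
  moreover have "filt_mu X E Q [G] [\<epsilon>]
      = 2 * (of_nat (vb_rank X E) * \<epsilon>) - 2 * \<epsilon> * of_nat (vb_rank X (sub_vb X E G))"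
    using step_max_single[OF Q wf1(2)] G by (simp add: filt_mu_eq[OF Q wf1(2)])
  moreover have "filt_mu X E Q [F, G] [\<epsilon>, \<epsilon>]
      = 2 * (of_nat (vb_rank X E) * \<epsilon>) - 2 * \<epsilon> * of_nat (vb_rank X (sub_vb X E F))
        - 2 * \<epsilon> * of_nat (vb_rank X (sub_vb X E G))"
    using step_max_critical_pair[OF assms] by (simp add: filt_mu_eq[OF Q wf] numeral_2_eq_2)
  ultimately show ?thesis
    using \<epsilon> r by (simp add: critical_def)
qed

text \<open>An instance of \<open>reduction_to_pairs\<close> with
  \<open>q k = sub_weight X E \<delta> (Fs ! k)\<close> and \<open>D = \<delta> * rank E\<close>;
  its atomic terms are the values of \<open>P + \<delta> \<mu>\<close> on subfiltrations of length
  one and on critical ones of length two.\<close>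

lemma stability_reduction:
  assumes Q: "quadric_bundle X N E Q"
    and K_add: "\<And>x y. x \<in> K \<Longrightarrow> y \<in> K \<Longrightarrow> x + y \<in> K"
    and single: "\<And>F \<epsilon>. weighted_filtration X E [F] [\<epsilon>] \<Longrightarrow>
      filt_P X E [F] [\<epsilon>] + \<delta> * filt_mu X E Q [F] [\<epsilon>] \<in> K"
    and pair: "\<And>F G \<epsilon> \<epsilon>'. weighted_filtration X E [F, G] [\<epsilon>, \<epsilon>'] \<Longrightarrow>
      critical X E Q [F, G] [\<epsilon>, \<epsilon>'] \<Longrightarrow>
      filt_P X E [F, G] [\<epsilon>, \<epsilon>'] + \<delta> * filt_mu X E Q [F, G] [\<epsilon>, \<epsilon>'] \<in> K"
    and wf: "weighted_filtration X E Fs \<alpha>s"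
  shows "filt_P X E Fs \<alpha>s + \<delta> * filt_mu X E Q Fs \<alpha>s \<in> K"
proof -
  define t where "t = length Fs"
  interpret staircase t "filt_support X E Q Fs"
    unfolding t_def using Q wf by (rule staircase_filt_support)
  have pos: "0 < \<alpha>s ! k" if "k < t" for k
    using wf that by (auto simp: weighted_filtration_def t_def)
  have "0 < t"
    using wf by (auto simp: weighted_filtration_def t_def)
  have "(\<Sum>k<t. \<alpha>s ! k * sub_weight X E \<delta> (Fs ! k))
      + \<delta> * of_nat (vb_rank X E) * step_max t (filt_support X E Q Fs) ((!) \<alpha>s) \<in> K"
  proof (rule reduction_to_pairs[OF K_add])
    fix k and \<epsilon> :: rat
    assume k: "k < t" and "0 < \<epsilon>"
    then have wf1: "weighted_filtration X E [Fs ! k] [\<epsilon>]"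
      using weighted_filtration_single[OF wf] by (simp add: t_def)
    have "filt_support X E Q [Fs ! k] 0 1 = filt_support X E Q Fs k t"
      "filt_support X E Q [Fs ! k] 0 0 = filt_support X E Q Fs k k"
      using k by (auto simp: filt_support_def nth_append t_def)
    then show "\<epsilon> * sub_weight X E \<delta> (Fs ! k) + \<delta> * of_nat (vb_rank X E)
        * (\<epsilon> * (of_bool (filt_support X E Q Fs k t) + of_bool (filt_support X E Q Fs k k))) \<in> K"
      using single[OF wf1] step_max_single[OF Q wf1] filt_P_plus_mu_eq[OF Q wf1, of \<delta>] by simp
  next
    fix a b and \<epsilon> :: rat
    assume ab: "a < b" "b < t" and "0 < \<epsilon>"
      and S: "filt_support X E Q Fs a t" "filt_support X E Q Fs b b" "\<not> filt_support X E Q Fs a b"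
    then have wf2: "weighted_filtration X E [Fs ! a, Fs ! b] [\<epsilon>, \<epsilon>]"
      using weighted_filtration_pair[OF wf] by (simp add: t_def)
    \<comment> \<open>Positions 0, 1, 2 of the short filtration are positions \<open>a\<close>,
      \<open>b\<close>, \<open>t\<close> of \<open>Fs @ [fibre E]\<close>.\<close>
    have S2: "filt_support X E Q [Fs ! a, Fs ! b] 0 2" "filt_support X E Q [Fs ! a, Fs ! b] 1 1"
      "\<not> filt_support X E Q [Fs ! a, Fs ! b] 0 1"
      using S ab by (auto simp: filt_support_def nth_append t_def)
    show "\<epsilon> * sub_weight X E \<delta> (Fs ! a) + \<epsilon> * sub_weight X E \<delta> (Fs ! b)
        + \<delta> * of_nat (vb_rank X E) * (2 * \<epsilon>) \<in> K"
      using pair[OF wf2 critical_pair[OF Q wf2 S2]] step_max_critical_pair[OF Q wf2 S2]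
        filt_P_plus_mu_eq[OF Q wf2, of \<delta>]
      by (simp add: numeral_2_eq_2)
  qed (use pos \<open>0 < t\<close> in \<open>force intro: less_imp_le\<close>)+
  then show ?thesis
    by (simp add: filt_P_plus_mu_eq[OF Q wf] t_def)
qed

text \<open>Handles semistability and stability together: \<open>K\<close> becomes
  \<open>{0..}\<close> or \<open>{0<..}\<close>, both closed under addition.\<close>

lemma stability_iff:
  assumes Q: "quadric_bundle X N E Q"
    and K_add: "\<And>x y. x \<in> K \<Longrightarrow> y \<in> K \<Longrightarrow> x + y \<in> K"
  shows "(\<forall>Fs \<alpha>s. weighted_filtration X E Fs \<alpha>s \<longrightarrow> filt_P X E Fs \<alpha>s + \<delta> * filt_mu X E Q Fs \<alpha>s \<in> K) \<longleftrightarrow>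
    (\<forall>F \<alpha>. weighted_filtration X E [F] [\<alpha>] \<longrightarrow>
       filt_P X E [F] [\<alpha>] + \<delta> * filt_mu X E Q [F] [\<alpha>] \<in> K) \<and>
    (\<forall>F G \<alpha> \<beta>. weighted_filtration X E [F, G] [\<alpha>, \<beta>] \<and> critical X E Q [F, G] [\<alpha>, \<beta>] \<longrightarrow>
       filt_P X E [F, G] [\<alpha>, \<beta>] + \<delta> * filt_mu X E Q [F, G] [\<alpha>, \<beta>] \<in> K)"
    (is "?L \<longleftrightarrow> ?R1 \<and> ?R2")
proof
  assume ?L
  then show "?R1 \<and> ?R2" by blast
next
  assume R: "?R1 \<and> ?R2"
  show ?L
  proof (intro allI impI)
    fix Fs \<alpha>s
    assume wf: "weighted_filtration X E Fs \<alpha>s"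
    show "filt_P X E Fs \<alpha>s + \<delta> * filt_mu X E Q Fs \<alpha>s \<in> K"
      by (rule stability_reduction[OF Q K_add _ _ wf]) (use R in blast)+
  qed
qed

theorem theorem11:
  fixes X :: "(complex ^ 'n) set set"
    and N :: "((complex ^ 'n) set, 'w::ab_group_add) vbundle"
    and E :: "((complex ^ 'n) set, 'v::ab_group_add) vbundle"
    and Q :: "(complex ^ 'n) set \<Rightarrow> (('v \<Rightarrow> complex) \<Rightarrow> complex) \<Rightarrow> 'w"
    and \<delta> :: rat
  assumes "smooth_projective_curve X" and "genus X \<ge> 1"
    and "line_bundle X N"
    and "\<delta> > 0"
    and "quadric_bundle X N E Q"
  shows "(delta_semistable X \<delta> E Q \<longleftrightarrow>
           (\<forall>F \<alpha>. weighted_filtration X E [F] [\<alpha>] \<longrightarrow>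
              filt_P X E [F] [\<alpha>] + \<delta> * filt_mu X E Q [F] [\<alpha>] \<ge> 0) \<and>
           (\<forall>E\<^sub>1 E\<^sub>2 \<alpha>\<^sub>1 \<alpha>\<^sub>2. weighted_filtration X E [E\<^sub>1, E\<^sub>2] [\<alpha>\<^sub>1, \<alpha>\<^sub>2] \<and>
              critical X E Q [E\<^sub>1, E\<^sub>2] [\<alpha>\<^sub>1, \<alpha>\<^sub>2] \<longrightarrow>
              filt_P X E [E\<^sub>1, E\<^sub>2] [\<alpha>\<^sub>1, \<alpha>\<^sub>2] + \<delta> * filt_mu X E Q [E\<^sub>1, E\<^sub>2] [\<alpha>\<^sub>1, \<alpha>\<^sub>2] \<ge> 0)) \<and>
         (delta_stable X \<delta> E Q \<longleftrightarrow>
           (\<forall>F \<alpha>. weighted_filtration X E [F] [\<alpha>] \<longrightarrow>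
              filt_P X E [F] [\<alpha>] + \<delta> * filt_mu X E Q [F] [\<alpha>] > 0) \<and>
           (\<forall>E\<^sub>1 E\<^sub>2 \<alpha>\<^sub>1 \<alpha>\<^sub>2. weighted_filtration X E [E\<^sub>1, E\<^sub>2] [\<alpha>\<^sub>1, \<alpha>\<^sub>2] \<and>
              critical X E Q [E\<^sub>1, E\<^sub>2] [\<alpha>\<^sub>1, \<alpha>\<^sub>2] \<longrightarrow>
              filt_P X E [E\<^sub>1, E\<^sub>2] [\<alpha>\<^sub>1, \<alpha>\<^sub>2] + \<delta> * filt_mu X E Q [E\<^sub>1, E\<^sub>2] [\<alpha>\<^sub>1, \<alpha>\<^sub>2] > 0))"
  unfolding delta_semistable_def delta_stable_def
  using stability_iff[OF assms(5), of "{0..}" \<delta>, unfolded atLeast_iff, OF add_nonneg_nonneg]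
    stability_iff[OF assms(5), of "{0<..}" \<delta>, unfolded greaterThan_iff, OF add_pos_pos]
  by (rule conjI)

end
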